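(* For any integer $\gamma \geq 0$, the group of symmetries of $\mathsf{Dias}_\gamma$ as a set-operad contains two elements: the identity map and the linear map sending any word of $\mathsf{Dias}_\gamma$ to its mirror image.
   Context: Write $[\gamma] = \{1, \dots, \gamma\}$ (empty if $\gamma = 0$). A set-operad is a nonsymmetric operad in sets, described by partial compositions $\circ_i$ and a unit; it gives rise to an operad on the linear span of its elements by extending the partial compositions linearly. $\mathsf{Dias}_\gamma$ is the set-operad generated by the two-letter words $0a$ and $a0$, $a \in [\gamma]$, inside the set-operad $\mathsf{T}\mathcal{M}_\gamma$ whose elements of arity $n \ge 1$ are all words of length $n$ on $\{0\} \cup [\gamma]$, with partial compositions $u \circ_i v := u_1 \dots u_{i-1}\,\max(u_i, v_1) \dots \max(u_i, v_m)\, u_{i+1} \dots u_n$ (for $u$ of length $n$, $v$ of length $m$, $1 \le i \le n$) and unit the word $0$. Its elements are exactly the words on $\{0\} \cup [\gamma]$ with exactly one occurrence of $0$. An operad morphism is a map (linear, in the setting of vector spaces) that respects arities, sends unit to unit, and commutes with partial compositions. An operad antimorphism is a map (linear, in the setting of vector spaces) $\phi$ that respects arities and satisfies $\phi(x \circ_i y) = \phi(x) \circ_{n-i+1} \phi(y)$ for all $x$ of arity $n$, all $y$, and all $1 \le i \le n$. A symmetry of an operad is either an automorphism or an antiautomorphism; here, the operad being considered as a set-operad, symmetries send words to words. The symmetries form a group under composition, called the group of symmetries. The mirror image of $x_1 \dots x_n$ is $x_n \dots x_1$.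
   Formalization: For γ = 0 the only word is 0, so the identity and the mirror map coincide and the group has one element; the formal theorem says the group consists of these two maps for all γ ≥ 0, and that there are exactly two of them only for γ ≥ 1. *)

theory Defs
  imports "HOL-Algebra.Bij" "HOL-Library.Poly_Mapping"
begin

section \<open>Nonsymmetric operads given by partial compositions\<close>

text \<open>
  The record only carries the data of an operad. The composition \<^term>\<open>pcomp O i x y\<close> is
  meaningful for \<^term>\<open>x \<in> ops O n\<close>, \<^term>\<open>y \<in> ops O m\<close> and
  \<^term>\<open>i \<in> {1..n}\<close>, and then has arity \<^term>\<open>n + m - 1\<close>.
\<close>

record 'a operad =
  ops :: "nat \<Rightarrow> 'a set"
  pcomp :: "nat \<Rightarrow> 'a \<Rightarrow> 'a \<Rightarrow> 'a"
  op_unit :: 'a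

definition all_ops :: "'a operad \<Rightarrow> 'a set" where
  "all_ops P = (\<Union>n. ops P n)"

inductive suboperad_mem :: "'a operad \<Rightarrow> 'a set \<Rightarrow> nat \<Rightarrow> 'a \<Rightarrow> bool"
  for P :: "'a operad" and G :: "'a set" where
  unit: "suboperad_mem P G 1 (op_unit P)"
| gen: "x \<in> G \<Longrightarrow> x \<in> ops P n \<Longrightarrow> suboperad_mem P G n x"
| comp: "suboperad_mem P G n x \<Longrightarrow> suboperad_mem P G m y \<Longrightarrow> i \<in> {1..n} \<Longrightarrow>
         suboperad_mem P G (n + m - 1) (pcomp P i x y)"

definition generated_suboperad :: "'a operad \<Rightarrow> 'a set \<Rightarrow> 'a operad" where
  "generated_suboperad P G =
     \<lparr>ops = (\<lambda>n. {x. suboperad_mem P G n x}), pcomp = pcomp P, op_unit = op_unit P\<rparr>"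

definition operad_morphism :: "'a operad \<Rightarrow> 'b operad \<Rightarrow> ('a \<Rightarrow> 'b) \<Rightarrow> bool" where
  "operad_morphism P Q f \<longleftrightarrow>
     (\<forall>n. f ` ops P n \<subseteq> ops Q n) \<and>
     f (op_unit P) = op_unit Q \<and>
     (\<forall>n m. \<forall>x\<in>ops P n. \<forall>y\<in>ops P m. \<forall>i\<in>{1..n}.
        f (pcomp P i x y) = pcomp Q i (f x) (f y))"

definition operad_antimorphism :: "'a operad \<Rightarrow> 'b operad \<Rightarrow> ('a \<Rightarrow> 'b) \<Rightarrow> bool" where
  "operad_antimorphism P Q f \<longleftrightarrow>
     (\<forall>n. f ` ops P n \<subseteq> ops Q n) \<and>
     (\<forall>n m. \<forall>x\<in>ops P n. \<forall>y\<in>ops P m. \<forall>i\<in>{1..n}.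
        f (pcomp P i x y) = pcomp Q (n - i + 1) (f x) (f y))"


section \<open>The operad on the linear span of a set-operad\<close>

text \<open>
  Vectors are finitely supported functions; \<^term>\<open>Poly_Mapping.single u 1\<close> is the basis vector
  of \<open>u\<close>. The underlying vector space is \<^term>\<open>span_space P\<close>, the direct sum over all
  arities of the spaces \<^term>\<open>ops (linear_span P) n\<close>.
\<close>

definition span_space :: "'a operad \<Rightarrow> ('a \<Rightarrow>\<^sub>0 'k::field) set" where
  "span_space P = {x. Poly_Mapping.keys x \<subseteq> all_ops P}"

definition basis_vectors :: "'a operad \<Rightarrow> ('a \<Rightarrow>\<^sub>0 'k::field) set" where
  "basis_vectors P = (\<lambda>u. Poly_Mapping.single u 1) ` all_ops P"

definition linear_span :: "'a operad \<Rightarrow> ('a \<Rightarrow>\<^sub>0 'k::field) operad" where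
  "linear_span P =
     \<lparr>ops = (\<lambda>n. {x. Poly_Mapping.keys x \<subseteq> ops P n}),
      pcomp = (\<lambda>i x y. \<Sum>u\<in>Poly_Mapping.keys x. \<Sum>v\<in>Poly_Mapping.keys y.
                 Poly_Mapping.single (pcomp P i u v)
                   (Poly_Mapping.lookup x u * Poly_Mapping.lookup y v)),
      op_unit = Poly_Mapping.single (op_unit P) 1\<rparr>"

definition linear_on_span :: "'a operad \<Rightarrow> (('a \<Rightarrow>\<^sub>0 'k::field) \<Rightarrow> ('b \<Rightarrow>\<^sub>0 'k)) \<Rightarrow> bool" where
  "linear_on_span P f \<longleftrightarrow>
     (\<forall>x\<in>span_space P. \<forall>y\<in>span_space P. f (x + y) = f x + f y) \<and>
     (\<forall>c. \<forall>x\<in>span_space P.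
        f (Poly_Mapping.map ((*) c) x) = Poly_Mapping.map ((*) c) (f x))"

definition linear_extension :: "('a \<Rightarrow> 'b) \<Rightarrow> ('a \<Rightarrow>\<^sub>0 'k::field) \<Rightarrow> ('b \<Rightarrow>\<^sub>0 'k)" where
  "linear_extension g x =
     (\<Sum>u\<in>Poly_Mapping.keys x. Poly_Mapping.single (g u) (Poly_Mapping.lookup x u))"


section \<open>Symmetries of a set-operad\<close>

text \<open>
  Symmetries are extensional bijections of the linear span (as in \<^const>\<open>Bij\<close>), so that
  two of them are equal as soon as they agree on \<^term>\<open>span_space P\<close>. Sending basis vectors to
  basis vectors is what it means to be a symmetry of \<open>P\<close> as a set-operad.
\<close>

definition symmetries :: "'a operad \<Rightarrow> (('a \<Rightarrow>\<^sub>0 'k::field) \<Rightarrow> ('a \<Rightarrow>\<^sub>0 'k)) set" where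
  "symmetries P =
     {f \<in> Bij (span_space P).
        linear_on_span P f \<and>
        f ` basis_vectors P \<subseteq> basis_vectors P \<and>
        (operad_morphism (linear_span P) (linear_span P) f \<or>
         operad_antimorphism (linear_span P) (linear_span P) f)}"

definition symmetry_group :: "'a operad \<Rightarrow> (('a \<Rightarrow>\<^sub>0 'k::field) \<Rightarrow> ('a \<Rightarrow>\<^sub>0 'k)) monoid" where
  "symmetry_group P = (BijGroup (span_space P))\<lparr>carrier := symmetries P\<rparr>"


section \<open>The operads of words\<close>

text \<open>Lists are indexed from 0, hence the letter \<open>u\<^sub>i\<close> is \<^term>\<open>u ! (i - 1)\<close>.\<close>

definition word_comp :: "nat \<Rightarrow> nat list \<Rightarrow> nat list \<Rightarrow> nat list" where
  "word_comp i u v = take (i - 1) u @ map (max (u ! (i - 1))) v @ drop i u"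

definition TM :: "nat \<Rightarrow> nat list operad" where
  "TM \<gamma> = \<lparr>ops = (\<lambda>n. {w. n \<ge> 1 \<and> length w = n \<and> set w \<subseteq> {0..\<gamma>}}),
          pcomp = word_comp, op_unit = [0]\<rparr>"

definition Dias :: "nat \<Rightarrow> nat list operad" where
  "Dias \<gamma> = generated_suboperad (TM \<gamma>) (\<Union>a\<in>{1..\<gamma>}. {[0, a], [a, 0]})"

end

theory Submission
  imports Defs
begin

text \<open>
  A symmetry is the linear extension of an arity-preserving injection \<open>g\<close> of words. Composing an
  antimorphism with the mirror image yields a morphism, so let \<open>g\<close> be a morphism. The identity
  \<open>0a \<circ>\<^sub>2 a0 = 0a \<circ>\<^sub>2 0a\<close> and its mirror image prevent \<open>g\<close> from exchanging the two kinds of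
  generators, so \<open>g\<close> maps \<open>0a\<close> to \<open>0\<sigma>(a)\<close> and \<open>a0\<close> to \<open>\<tau>(a)0\<close>. As
  \<open>0a \<circ>\<^sub>2 0b = 0a \<circ>\<^sub>2 0a\<close> holds exactly when \<open>b \<le> a\<close>, the injection \<open>\<sigma>\<close> of \<open>{1..\<gamma>}\<close> is
  monotone, hence the identity; the first identity then gives \<open>\<tau>(a) \<le> a\<close>, so \<open>\<tau>\<close> is the identity
  too. Thus \<open>g\<close> fixes the generators, and so every word.
\<close>

section \<open>Linear extensions\<close>

text \<open>Indices outside the support contribute \<open>single _ 0\<close>, which is zero. This
  lets sums over the supports of different vectors be compared over one finite set.\<close>

lemma linear_extension_superset:
  assumes "finite A" "Poly_Mapping.keys x \<subseteq> A"
  shows "linear_extension g x = (\<Sum>u\<in>A. Poly_Mapping.single (g u) (Poly_Mapping.lookup x u))"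
  unfolding linear_extension_def using assms
  by (intro sum.mono_neutral_left) (auto simp: in_keys_iff)

lemma linear_extension_single [simp]:
  "linear_extension g (Poly_Mapping.single u c) = Poly_Mapping.single (g u) c"
  by (simp add: linear_extension_def)

lemma linear_extension_add:
  "linear_extension g (x + y) = linear_extension g x + linear_extension g y"
proof -
  let ?A = "Poly_Mapping.keys x \<union> Poly_Mapping.keys y"
  have "finite ?A" "Poly_Mapping.keys (x + y) \<subseteq> ?A"
    by (auto simp: Poly_Mapping.keys_add)
  then show ?thesis
    by (simp add: linear_extension_superset[of ?A] lookup_add single_add sum.distrib)
qed

lemma linear_extension_zero [simp]: "linear_extension g 0 = 0"
  by (simp add: linear_extension_def)

lemma linear_extension_sum:
  "linear_extension g (\<Sum>i\<in>A. h i) = (\<Sum>i\<in>A. linear_extension g (h i))"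
  by (induction A rule: infinite_finite_induct) (simp_all add: linear_extension_add)

lemma lookup_map_mult [simp]:
  fixes x :: "'a \<Rightarrow>\<^sub>0 'k::field"
  shows "Poly_Mapping.lookup (Poly_Mapping.map ((*) c) x) w = c * Poly_Mapping.lookup x w"
  by (simp add: Poly_Mapping.map.rep_eq when_def)

lemma map_mult_single [simp]:
  fixes d :: "'k::field"
  shows "Poly_Mapping.map ((*) c) (Poly_Mapping.single u d) = Poly_Mapping.single u (c * d)"
  by (intro poly_mapping_eqI) (simp add: lookup_single when_def)

lemma map_mult_sum:
  fixes h :: "'i \<Rightarrow> ('a \<Rightarrow>\<^sub>0 'k::field)"
  shows "Poly_Mapping.map ((*) c) (\<Sum>i\<in>A. h i) = (\<Sum>i\<in>A. Poly_Mapping.map ((*) c) (h i))"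
  by (intro poly_mapping_eqI) (simp add: lookup_sum sum_distrib_left)

lemma keys_map_mult:
  fixes x :: "'a \<Rightarrow>\<^sub>0 'k::field"
  shows "Poly_Mapping.keys (Poly_Mapping.map ((*) c) x) \<subseteq> Poly_Mapping.keys x"
  by (auto simp: in_keys_iff)

lemma linear_extension_scale:
  "linear_extension g (Poly_Mapping.map ((*) c) x) = Poly_Mapping.map ((*) c) (linear_extension g x)"
proof -
  have "linear_extension g (Poly_Mapping.map ((*) c) x) =
      (\<Sum>u\<in>Poly_Mapping.keys x. Poly_Mapping.single (g u) (c * Poly_Mapping.lookup x u))"
    by (subst linear_extension_superset[of "Poly_Mapping.keys x"]) (simp_all add: keys_map_mult)
  also have "\<dots> = Poly_Mapping.map ((*) c) (linear_extension g x)"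
    by (simp add: linear_extension_def map_mult_sum)
  finally show ?thesis .
qed

lemma sum_single_lookup:
  "(\<Sum>u\<in>Poly_Mapping.keys x. Poly_Mapping.single u (Poly_Mapping.lookup x u)) = x"
  by (intro poly_mapping_eqI) (simp add: lookup_sum lookup_single when_def in_keys_iff)

lemma linear_extension_id:
  assumes "\<And>u. u \<in> Poly_Mapping.keys x \<Longrightarrow> g u = u"
  shows "linear_extension g x = x"
proof -
  have "linear_extension g x =
      (\<Sum>u\<in>Poly_Mapping.keys x. Poly_Mapping.single u (Poly_Mapping.lookup x u))"
    using assms by (simp add: linear_extension_def)
  then show ?thesis by (simp add: sum_single_lookup)
qed

text \<open>Functoriality, from additivity and the values on basis vectors. It later turns inverse
  bijections of words, and the involution \<open>rev\<close>, into inverse linear maps.\<close>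

lemma linear_extension_comp:
  "linear_extension g (linear_extension h x) = linear_extension (g \<circ> h) x"
  by (simp add: linear_extension_def[of h] linear_extension_def[of "g \<circ> h"] linear_extension_sum)

text \<open>An injective \<open>g\<close> merges no basis vectors, so at most one term of the sum
  contributes to the coefficient at \<open>g u\<close>.\<close>

lemma lookup_linear_extension_inj:
  assumes "inj g"
  shows "Poly_Mapping.lookup (linear_extension g x) (g u) = Poly_Mapping.lookup x u"
proof -
  have "Poly_Mapping.lookup (linear_extension g x) (g u) =
      (\<Sum>v\<in>Poly_Mapping.keys x. if v = u then Poly_Mapping.lookup x v else 0)"
    using assms by (auto simp: linear_extension_def lookup_sum lookup_single when_def inj_eq
        intro!: sum.cong)
  then show ?thesis by (auto simp: in_keys_iff)
qed

lemma keys_linear_extension_subset: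
  "Poly_Mapping.keys (linear_extension g x) \<subseteq> g ` Poly_Mapping.keys x"
proof
  fix w assume "w \<in> Poly_Mapping.keys (linear_extension g x)"
  then have "(\<Sum>u\<in>Poly_Mapping.keys x. (Poly_Mapping.lookup x u when g u = w)) \<noteq> 0"
    by (simp add: in_keys_iff linear_extension_def lookup_sum lookup_single)
  then obtain u where "u \<in> Poly_Mapping.keys x" "(Poly_Mapping.lookup x u when g u = w) \<noteq> 0"
    by (rule sum.not_neutral_contains_not_neutral)
  then show "w \<in> g ` Poly_Mapping.keys x"
    by (auto simp: when_def split: if_splits)
qed

lemma keys_linear_extension_inj:
  assumes "inj g"
  shows "Poly_Mapping.keys (linear_extension g x) = g ` Poly_Mapping.keys x"
  using keys_linear_extension_subset[of g x] lookup_linear_extension_inj[OF assms, of x]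
  by (auto simp: in_keys_iff)

section \<open>Linear maps on the span versus linear extensions\<close>

lemma linear_on_span_restrict_linear_extension:
  fixes P :: "'a operad"
  shows "linear_on_span P (restrict (linear_extension g :: ('a \<Rightarrow>\<^sub>0 'k::field) \<Rightarrow> ('b \<Rightarrow>\<^sub>0 'k))
    (span_space P))"
proof -
  have "x + y \<in> span_space P" if "x \<in> span_space P" "y \<in> span_space P" for x y :: "'a \<Rightarrow>\<^sub>0 'k"
    using that Poly_Mapping.keys_add[of x y] by (auto simp: span_space_def)
  moreover have "Poly_Mapping.map ((*) c) x \<in> span_space P" if "x \<in> span_space P"
    for c and x :: "'a \<Rightarrow>\<^sub>0 'k"
    using that keys_map_mult[of c x] by (auto simp: span_space_def)
  ultimately show ?thesis
    by (simp add: linear_on_span_def linear_extension_add linear_extension_scale)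
qed

lemma linear_on_span_eq_linear_extension:
  fixes f :: "('a \<Rightarrow>\<^sub>0 'k::field) \<Rightarrow> ('b \<Rightarrow>\<^sub>0 'k)"
  assumes lin: "linear_on_span P f"
    and g: "\<And>u. u \<in> all_ops P \<Longrightarrow> f (Poly_Mapping.single u 1) = Poly_Mapping.single (g u) 1"
    and x: "x \<in> span_space P"
  shows "f x = linear_extension g x"
proof -
  have scale: "f (Poly_Mapping.map ((*) c) y) = Poly_Mapping.map ((*) c) (f y)"
    if "y \<in> span_space P" for c y
    using lin that by (simp add: linear_on_span_def)
  \<comment> \<open>The value at zero comes from compatibility with scaling, applied to the scalar
    0.\<close>
  have f0: "f 0 = 0"
  proof -
    have *: "Poly_Mapping.map ((*) 0) y = 0" for y :: "'c \<Rightarrow>\<^sub>0 'k"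
      by (intro poly_mapping_eqI) simp
    show ?thesis using scale[of 0 0] by (simp add: * span_space_def)
  qed
  have single: "f (Poly_Mapping.single u c) = Poly_Mapping.single (g u) c" if "u \<in> all_ops P" for u c
    using scale[of "Poly_Mapping.single u 1" c] g[OF that] that by (simp add: span_space_def)
  let ?t = "\<lambda>u. Poly_Mapping.single u (Poly_Mapping.lookup x u)"
  \<comment> \<open>Induction over finite sets of basis elements. Membership in the span is carried
    along because \<open>f\<close> is linear only there.\<close>
  have "sum ?t A \<in> span_space P \<and> f (sum ?t A) = linear_extension g (sum ?t A)"
    if "finite A" "A \<subseteq> all_ops P" for A
    using that
  proof induction
    case empty
    then show ?case by (simp add: f0 span_space_def)
  next
    case (insert u A)
    then have "?t u \<in> span_space P" "sum ?t A \<in> span_space P"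
      by (auto simp: span_space_def)
    moreover from this have "?t u + sum ?t A \<in> span_space P"
      using Poly_Mapping.keys_add[of "?t u" "sum ?t A"] by (auto simp: span_space_def)
    ultimately show ?case
      using insert lin by (simp add: linear_on_span_def linear_extension_add single)
  qed
  from this[of "Poly_Mapping.keys x"] show ?thesis
    using x by (simp add: span_space_def sum_single_lookup)
qed

section \<open>Symmetries and maps of operations\<close>

lemma pcomp_linear_span_single [simp]:
  "pcomp (linear_span P) i (Poly_Mapping.single u (1::'k::field)) (Poly_Mapping.single v 1) =
    Poly_Mapping.single (pcomp P i u v) 1"
  by (simp add: linear_span_def)

lemma single_one_inj:
  "Poly_Mapping.single u (1::'k::field) = Poly_Mapping.single v 1 \<Longrightarrow> u = v"
  by (metis lookup_single_eq lookup_single_not_eq zero_neq_one)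

text \<open>Passes from the linear map to a map of operations: \<open>f\<close> sends basis vectors
  to basis vectors, so \<open>g\<close> can be read off, and distinct operations have distinct basis
  vectors, so injectivity, arities and compositions transfer from \<open>f\<close> to
  \<open>g\<close>. Closure under composition ensures that \<open>g\<close> also describes
  \<open>f\<close> on composites.\<close>

lemma symmetryE:
  fixes f :: "('a \<Rightarrow>\<^sub>0 'k::field) \<Rightarrow> ('a \<Rightarrow>\<^sub>0 'k)"
  assumes f: "f \<in> symmetries P"
    and unit: "op_unit P \<in> all_ops P"
    and closed: "\<And>n m x y i. x \<in> ops P n \<Longrightarrow> y \<in> ops P m \<Longrightarrow> i \<in> {1..n} \<Longrightarrow>
      pcomp P i x y \<in> all_ops P"
  obtains g where "inj_on g (all_ops P)" "operad_morphism P P g \<or> operad_antimorphism P P g"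
    "f = restrict (linear_extension g) (span_space P)"
proof -
  have bij: "f \<in> Bij (span_space P)" and lin: "linear_on_span P f"
    and basis: "f ` basis_vectors P \<subseteq> basis_vectors P"
    and mor: "operad_morphism (linear_span P) (linear_span P) f \<or>
      operad_antimorphism (linear_span P) (linear_span P) f"
    using f by (auto simp: symmetries_def)
  have "\<forall>u\<in>all_ops P. \<exists>v\<in>all_ops P. f (Poly_Mapping.single u 1) = Poly_Mapping.single v 1"
    using basis by (force simp: basis_vectors_def)
  then obtain g where g: "\<And>u. u \<in> all_ops P \<Longrightarrow> f (Poly_Mapping.single u 1) = Poly_Mapping.single (g u) 1"
    by metis
  have ops: "u \<in> all_ops P" if "u \<in> ops P n" for u n
    using that by (auto simp: all_ops_def)
  have in_span: "Poly_Mapping.single u (1::'k) \<in> ops (linear_span P) n" if "u \<in> ops P n" for u n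
    using that by (simp add: linear_span_def)
  have "inj_on g (all_ops P)"
  proof (rule inj_onI)
    fix u v assume uv: "u \<in> all_ops P" "v \<in> all_ops P" "g u = g v"
    then have "f (Poly_Mapping.single u 1) = f (Poly_Mapping.single v 1)"
      by (simp add: g)
    moreover have "inj_on f (span_space P)"
      using bij by (auto simp: Bij_def bij_betw_def)
    moreover have "Poly_Mapping.single u (1::'k) \<in> span_space P"
      "Poly_Mapping.single v (1::'k) \<in> span_space P"
      using uv by (simp_all add: span_space_def)
    ultimately have "Poly_Mapping.single u (1::'k) = Poly_Mapping.single v 1"
      by (meson inj_onD)
    then show "u = v" by (rule single_one_inj)
  qed
  moreover have "operad_morphism P P g \<or> operad_antimorphism P P g"
  proof -
    have ar: "g u \<in> ops P n" if "u \<in> ops P n" for u n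
    proof -
      have "f (Poly_Mapping.single u 1) \<in> ops (linear_span P) n"
        using mor in_span[OF that] by (auto simp: operad_morphism_def operad_antimorphism_def)
      then show ?thesis
        by (simp add: g[OF ops[OF that]] linear_span_def)
    qed
    from mor show ?thesis
    proof
      assume m: "operad_morphism (linear_span P) (linear_span P) f"
      have "g (op_unit P) = op_unit P"
      proof (rule single_one_inj[where 'k = 'k])
        show "Poly_Mapping.single (g (op_unit P)) (1::'k) = Poly_Mapping.single (op_unit P) 1"
          using m g[OF unit] by (simp add: operad_morphism_def linear_span_def)
      qed
      moreover have "g (pcomp P i x y) = pcomp P i (g x) (g y)"
        if "x \<in> ops P n" "y \<in> ops P m" "i \<in> {1..n}" for n m x y i
      proof (rule single_one_inj[where 'k = 'k])
        have "f (pcomp (linear_span P) i (Poly_Mapping.single x 1) (Poly_Mapping.single y 1)) =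
            pcomp (linear_span P) i (f (Poly_Mapping.single x 1)) (f (Poly_Mapping.single y 1))"
          using m in_span[OF that(1)] in_span[OF that(2)] that(3)
          unfolding operad_morphism_def by blast
        then show "Poly_Mapping.single (g (pcomp P i x y)) (1::'k) =
            Poly_Mapping.single (pcomp P i (g x) (g y)) 1"
          using that by (simp add: g ops[OF that(1)] ops[OF that(2)] closed[OF that])
      qed
      ultimately show ?thesis using ar by (auto simp: operad_morphism_def)
    next
      assume m: "operad_antimorphism (linear_span P) (linear_span P) f"
      have "g (pcomp P i x y) = pcomp P (n - i + 1) (g x) (g y)"
        if "x \<in> ops P n" "y \<in> ops P m" "i \<in> {1..n}" for n m x y i
      proof (rule single_one_inj[where 'k = 'k])
        have "f (pcomp (linear_span P) i (Poly_Mapping.single x 1) (Poly_Mapping.single y 1)) =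
            pcomp (linear_span P) (n - i + 1)
              (f (Poly_Mapping.single x 1)) (f (Poly_Mapping.single y 1))"
          using m in_span[OF that(1)] in_span[OF that(2)] that(3)
          unfolding operad_antimorphism_def by blast
        then show "Poly_Mapping.single (g (pcomp P i x y)) (1::'k) =
            Poly_Mapping.single (pcomp P (n - i + 1) (g x) (g y)) 1"
          using that by (simp add: g ops[OF that(1)] ops[OF that(2)] closed[OF that])
      qed
      then show ?thesis using ar by (auto simp: operad_antimorphism_def)
    qed
  qed
  \<comment> \<open>Both sides are extensional, so agreement on the span gives equality of
    functions.\<close>
  moreover have "f = restrict (linear_extension g) (span_space P)"
    using bij linear_on_span_eq_linear_extension[OF lin g]
    by (auto simp: Bij_def intro!: extensionalityI)
  ultimately show ?thesis by (rule that)
qed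

section \<open>From maps of operations back to symmetries\<close>

lemma linear_extension_pcomp:
  fixes x y :: "'a \<Rightarrow>\<^sub>0 'k::field"
  assumes "inj g"
    and "\<And>u v. u \<in> Poly_Mapping.keys x \<Longrightarrow> v \<in> Poly_Mapping.keys y \<Longrightarrow>
      g (pcomp P i u v) = pcomp Q j (g u) (g v)"
  shows "linear_extension g (pcomp (linear_span P) i x y) =
    pcomp (linear_span Q) j (linear_extension g x) (linear_extension g y)"
proof -
  \<comment> \<open>Extension along an injection sends supports to their images and keeps
    coefficients, so the double sum on the right reindexes along \<open>g\<close> to the one on the
    left. The position \<open>j\<close> is independent of \<open>i\<close>, which covers morphisms
    and antimorphisms at once.\<close>
  have inj: "inj_on g A" for A using assms(1) by (rule inj_on_subset) simp
  show ?thesis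
    using assms
    by (simp add: linear_span_def linear_extension_sum keys_linear_extension_inj
        sum.reindex[OF inj] lookup_linear_extension_inj cong: sum.cong)
qed

text \<open>A nonzero coefficient of the double sum requires a nonzero summand, and that summand
  names \<open>u\<close> and \<open>v\<close>.\<close>

lemma keys_pcomp_linear_span:
  fixes x y :: "'a \<Rightarrow>\<^sub>0 'k::field"
  assumes "w \<in> Poly_Mapping.keys (pcomp (linear_span P) i x y)"
  shows "\<exists>u\<in>Poly_Mapping.keys x. \<exists>v\<in>Poly_Mapping.keys y. w = pcomp P i u v"
proof -
  from assms have "(\<Sum>u\<in>Poly_Mapping.keys x. \<Sum>v\<in>Poly_Mapping.keys y.
      (Poly_Mapping.lookup x u * Poly_Mapping.lookup y v when pcomp P i u v = w)) \<noteq> 0"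
    by (simp add: in_keys_iff linear_span_def lookup_sum lookup_single)
  then obtain u where u: "u \<in> Poly_Mapping.keys x" and "(\<Sum>v\<in>Poly_Mapping.keys y.
      (Poly_Mapping.lookup x u * Poly_Mapping.lookup y v when pcomp P i u v = w)) \<noteq> 0"
    by (rule sum.not_neutral_contains_not_neutral)
  from this(2) obtain v where "v \<in> Poly_Mapping.keys y"
      "(Poly_Mapping.lookup x u * Poly_Mapping.lookup y v when pcomp P i u v = w) \<noteq> 0"
    by (rule sum.not_neutral_contains_not_neutral)
  with u show ?thesis by (auto simp: when_def split: if_splits)
qed

text \<open>A converse to \<open>symmetryE\<close>, made to be applied to \<open>id\<close> and
  \<open>rev\<close>, which are bijections of all words and preserve every arity.\<close>

lemma linear_extension_in_symmetries:
  fixes P :: "'a operad"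
  assumes bij: "bij g"
    and ops: "\<And>n. g ` ops P n = ops P n"
    and unit: "op_unit P \<in> all_ops P"
    and closed: "\<And>n m x y i. x \<in> ops P n \<Longrightarrow> y \<in> ops P m \<Longrightarrow> i \<in> {1..n} \<Longrightarrow>
      pcomp P i x y \<in> all_ops P"
    and mor: "operad_morphism P P g \<or> operad_antimorphism P P g"
  shows "restrict (linear_extension g) (span_space P) \<in>
    (symmetries P :: (('a \<Rightarrow>\<^sub>0 'k::field) \<Rightarrow> ('a \<Rightarrow>\<^sub>0 'k)) set)"
proof -
  let ?f = "restrict (linear_extension g) (span_space P) :: ('a \<Rightarrow>\<^sub>0 'k) \<Rightarrow> ('a \<Rightarrow>\<^sub>0 'k)"
  have inj: "inj g" and inv_g: "g \<circ> inv_into UNIV g = id" "inv_into UNIV g \<circ> g = id"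
    using bij by (auto simp: bij_is_inj surj_iff[THEN iffD1, OF bij_is_surj])
  have all: "g ` all_ops P = all_ops P"
    using ops by (simp add: all_ops_def image_UN)
  then have inv_all: "inv_into UNIV g ` all_ops P = all_ops P"
    by (metis image_inv_f_f inj)
  have "bij_betw (linear_extension g) (span_space P) (span_space P :: ('a \<Rightarrow>\<^sub>0 'k) set)"
  \<comment> \<open>The inverse is the linear extension of the inverse of \<open>g\<close>.\<close>
  proof (rule bij_betw_byWitness[where f' = "linear_extension (inv_into UNIV g)"])
    show "linear_extension g ` span_space P \<subseteq> (span_space P :: ('a \<Rightarrow>\<^sub>0 'k) set)"
      "linear_extension (inv_into UNIV g) ` span_space P \<subseteq> (span_space P :: ('a \<Rightarrow>\<^sub>0 'k) set)"
      using all inv_all keys_linear_extension_subset by (fastforce simp: span_space_def)+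
  qed (simp_all add: linear_extension_comp inv_g linear_extension_id)
  then have "?f \<in> Bij (span_space P)"
    by (simp add: Bij_def)
  moreover have "?f ` basis_vectors P \<subseteq> basis_vectors P"
    using all by (auto simp: basis_vectors_def span_space_def intro!: imageI)
  moreover have "operad_morphism (linear_span P) (linear_span P) ?f \<or>
      operad_antimorphism (linear_span P) (linear_span P) ?f"
  proof -
    have sp: "x \<in> span_space P" if "x \<in> ops (linear_span P) n" for x :: "'a \<Rightarrow>\<^sub>0 'k" and n
      using that by (auto simp: linear_span_def span_space_def all_ops_def)
    have ar: "?f x \<in> ops (linear_span P) n" if "x \<in> ops (linear_span P) n" for x n
      using that sp[OF that] keys_linear_extension_subset[of g x] ops[of n]
      by (fastforce simp: linear_span_def)
    \<comment> \<open>The map \<open>?f\<close> agrees with the linear extension only on the span,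
      so composites must first be located there.\<close>
    have comp_sp: "pcomp (linear_span P) i x y \<in> span_space P"
      if "x \<in> ops (linear_span P) n" "y \<in> ops (linear_span P) m" "i \<in> {1..n}"
      for x y :: "'a \<Rightarrow>\<^sub>0 'k" and n m i
      unfolding span_space_def
    proof safe
      fix w assume "w \<in> Poly_Mapping.keys (pcomp (linear_span P) i x y)"
      from keys_pcomp_linear_span[OF this] that show "w \<in> all_ops P"
        using closed by (fastforce simp: linear_span_def)
    qed
    have comp: "?f (pcomp (linear_span P) i x y) = pcomp (linear_span P) j (?f x) (?f y)"
      if "x \<in> ops (linear_span P) n" "y \<in> ops (linear_span P) m" "i \<in> {1..n}"
        "\<And>u v. u \<in> ops P n \<Longrightarrow> v \<in> ops P m \<Longrightarrow> g (pcomp P i u v) = pcomp P j (g u) (g v)"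
      for x y n m i j
      using that comp_sp[OF that(1-3)] sp[OF that(1)] sp[OF that(2)]
        linear_extension_pcomp[OF inj, of x y P i P j]
      by (auto simp: linear_span_def)
    from mor show ?thesis
    proof
      assume m: "operad_morphism P P g"
      have "?f (op_unit (linear_span P)) = op_unit (linear_span P)"
        using m unit by (simp add: operad_morphism_def linear_span_def span_space_def)
      moreover have "?f (pcomp (linear_span P) i x y) = pcomp (linear_span P) i (?f x) (?f y)"
        if "x \<in> ops (linear_span P) n" "y \<in> ops (linear_span P) m" "i \<in> {1..n}" for x y n m i
        using m that by (intro comp[OF that]) (auto simp: operad_morphism_def)
      ultimately have "operad_morphism (linear_span P) (linear_span P) ?f"
        using ar unfolding operad_morphism_def by blast
      then show ?thesis ..
    next
      assume m: "operad_antimorphism P P g"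
      have "?f (pcomp (linear_span P) i x y) = pcomp (linear_span P) (n - i + 1) (?f x) (?f y)"
        if "x \<in> ops (linear_span P) n" "y \<in> ops (linear_span P) m" "i \<in> {1..n}" for x y n m i
        using m that by (intro comp[OF that]) (auto simp: operad_antimorphism_def)
      then have "operad_antimorphism (linear_span P) (linear_span P) ?f"
        using ar unfolding operad_antimorphism_def by blast
      then show ?thesis ..
    qed
  qed
  ultimately show ?thesis
    using linear_on_span_restrict_linear_extension by (simp add: symmetries_def)
qed

section \<open>Words\<close>

lemma length_word_comp:
  assumes "i \<in> {1..length u}"
  shows "length (word_comp i u v) = length u + length v - 1"
  using assms by (auto simp: word_comp_def)

text \<open>Position \<open>i\<close> from the left is position \<open>length u - i + 1\<close> in
  the reversed word, and taking maxima with a fixed letter acts letterwise, so it commutes with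
  reversal.\<close>

lemma rev_word_comp:
  assumes "i \<in> {1..length u}"
  shows "rev (word_comp i u v) = word_comp (length u - i + 1) (rev u) (rev v)"
  using assms by (auto simp: word_comp_def rev_map rev_take rev_drop rev_nth Suc_diff_le)

lemma count_list_map_max_0:
  "count_list (map (max a) v) 0 = (if a = 0 then count_list v 0 else 0)" for a :: nat
proof (cases "a = 0")
  case True
  have "max (0::nat) = id" by auto
  with True show ?thesis by simp
next
  case False
  then show ?thesis by (induction v) auto
qed

text \<open>If the only 0 of \<open>u\<close> stands at position \<open>i\<close>, it is replaced by
  an unchanged copy of \<open>v\<close> with its single 0. Otherwise it survives outside the
  inserted block, whose letters are all positive.\<close>

lemma count_list_word_comp_0:
  assumes "i \<in> {1..length u}" "count_list u 0 = 1" "count_list v 0 = 1"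
  shows "count_list (word_comp i u v) 0 = 1"
proof -
  have "u = take (i - 1) u @ u ! (i - 1) # drop i u"
    using assms(1) id_take_nth_drop[of "i - 1" u] by auto
  then have "count_list u 0 = count_list (take (i - 1) u @ u ! (i - 1) # drop i u) 0"
    by (rule arg_cong)
  then have "count_list u 0 = count_list (take (i - 1) u) 0 +
      (if u ! (i - 1) = 0 then 1 else 0) + count_list (drop i u) 0"
    by simp
  then show ?thesis
    using assms by (simp add: word_comp_def count_list_map_max_0 del: One_nat_def split: if_splits)
qed

lemma set_word_comp:
  assumes "i \<in> {1..length u}" "set u \<subseteq> {0..c}" "set v \<subseteq> {0..c}"
  shows "set (word_comp i u v) \<subseteq> {0..c}"
proof -
  have "u ! (i - 1) \<in> set u" using assms(1) by auto
  then show ?thesis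
    using assms set_take_subset[of "i - 1" u] set_drop_subset[of i u]
    by (fastforce simp: word_comp_def)
qed

section \<open>The operad Dias\<close>

lemma Dias_simps [simp]:
  "pcomp (Dias \<gamma>) = word_comp" "op_unit (Dias \<gamma>) = [0]"
  by (simp_all add: Dias_def generated_suboperad_def TM_def)

lemma Dias_unit: "[0] \<in> ops (Dias \<gamma>) 1"
  using suboperad_mem.unit[of "TM \<gamma>"] by (auto simp: Dias_def generated_suboperad_def TM_def)

lemma Dias_gen:
  assumes "a \<in> {1..\<gamma>}"
  shows "[0, a] \<in> ops (Dias \<gamma>) 2" "[a, 0] \<in> ops (Dias \<gamma>) 2"
  using assms
  by (auto simp: Dias_def generated_suboperad_def TM_def intro!: suboperad_mem.gen)

lemma Dias_comp:
  assumes "x \<in> ops (Dias \<gamma>) n" "y \<in> ops (Dias \<gamma>) m" "i \<in> {1..n}"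
  shows "word_comp i x y \<in> ops (Dias \<gamma>) (n + m - 1)"
  using assms suboperad_mem.comp[of "TM \<gamma>" _ n x m y i]
  by (auto simp: Dias_def generated_suboperad_def TM_def)

text \<open>Rule induction for the generated suboperad. Generators appear in arity 2 only, since the
  arity in \<open>TM\<close> is the word length.\<close>

lemma Dias_induct [consumes 1, case_names unit left right comp]:
  assumes "w \<in> ops (Dias \<gamma>) n"
    and "P 1 [0]"
    and "\<And>a. a \<in> {1..\<gamma>} \<Longrightarrow> P 2 [0, a]"
    and "\<And>a. a \<in> {1..\<gamma>} \<Longrightarrow> P 2 [a, 0]"
    and "\<And>n x m y i. x \<in> ops (Dias \<gamma>) n \<Longrightarrow> P n x \<Longrightarrow> y \<in> ops (Dias \<gamma>) m \<Longrightarrow> P m y \<Longrightarrow>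
      i \<in> {1..n} \<Longrightarrow> P (n + m - 1) (word_comp i x y)"
  shows "P n w"
proof -
  let ?G = "\<Union>a\<in>{1..\<gamma>}. {[0, a], [a, 0]}"
  have mem: "w \<in> ops (Dias \<gamma>) n \<longleftrightarrow> suboperad_mem (TM \<gamma>) ?G n w" for n w
    by (simp add: Dias_def generated_suboperad_def)
  have "suboperad_mem (TM \<gamma>) ?G n w" using assms(1) mem by blast
  then show ?thesis
  proof induction
    case unit
    then show ?case using assms(2) by (simp add: TM_def)
  next
    case (gen x n)
    then obtain a where "a \<in> {1..\<gamma>}" "x = [0, a] \<or> x = [a, 0]" "n = 2"
      by (auto simp: TM_def)
    then show ?case using assms(3,4) by auto
  next
    case (comp n x m y i)
    have "pcomp (TM \<gamma>) = word_comp" by (simp add: TM_def)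
    then show ?case
      using assms(5)[of x n y m i] comp mem[of x n] mem[of y m] by simp
  qed
qed

lemma Dias_words:
  assumes "w \<in> ops (Dias \<gamma>) n"
  shows "length w = n \<and> set w \<subseteq> {0..\<gamma>} \<and> count_list w 0 = 1"
  using assms
proof (induction rule: Dias_induct)
  case (comp n x m y i)
  then have "i \<in> {1..length x}" by simp
  with comp show ?case
    using length_word_comp[of i x y] set_word_comp[of i x \<gamma> y] count_list_word_comp_0[of i x y]
    by simp
qed auto

section \<open>Elements of arity one and two\<close>

lemma Dias_arity_1:
  assumes "w \<in> ops (Dias \<gamma>) 1"
  shows "w = [0]"
proof -
  note w = Dias_words[OF assms]
  then obtain a where "w = [a]" by (cases w) auto
  with w show ?thesis by (cases "a = 0") auto
qed

lemma Dias_arity_2: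
  assumes "w \<in> ops (Dias \<gamma>) 2"
  obtains a where "a \<in> {1..\<gamma>}" "w = [0, a]" | a where "a \<in> {1..\<gamma>}" "w = [a, 0]"
proof -
  note w = Dias_words[OF assms]
  then obtain a b where ab: "w = [a, b]"
    by (cases w; cases "tl w") auto
  show ?thesis
  proof (cases "a = 0")
    case True
    with w ab have "b \<in> {1..\<gamma>}" by (cases "b = 0") auto
    with True ab that(1) show ?thesis by simp
  next
    case False
    with w ab have "b = 0" by (cases "b = 0") auto
    with False w ab that(2)[of a] show ?thesis by auto
  qed
qed

lemma Dias_closed:
  "op_unit (Dias \<gamma>) \<in> all_ops (Dias \<gamma>)"
  "x \<in> ops (Dias \<gamma>) n \<Longrightarrow> y \<in> ops (Dias \<gamma>) m \<Longrightarrow> i \<in> {1..n} \<Longrightarrow>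
    pcomp (Dias \<gamma>) i x y \<in> all_ops (Dias \<gamma>)"
  using Dias_unit Dias_comp[of x \<gamma> n y m i] by (auto simp: all_ops_def)

section \<open>The mirror image on Dias\<close>

lemma Dias_rev: "w \<in> ops (Dias \<gamma>) n \<Longrightarrow> rev w \<in> ops (Dias \<gamma>) n"
proof (induction rule: Dias_induct)
  case (comp n x m y i)
  have "length x = n" using comp Dias_words by blast
  then show ?case
    using comp Dias_comp[of "rev x" \<gamma> n "rev y" m "n - i + 1"] by (auto simp: rev_word_comp)
qed (use Dias_unit Dias_gen in auto)

lemma operad_antimorphism_rev: "operad_antimorphism (Dias \<gamma>) (Dias \<gamma>) rev"
proof -
  have "rev (word_comp i x y) = word_comp (n - i + 1) (rev x) (rev y)"
    if "x \<in> ops (Dias \<gamma>) n" "i \<in> {1..n}" for x y n i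
    using Dias_words[OF that(1)] that(2) rev_word_comp[of i x y] by simp
  then show ?thesis
    using Dias_rev unfolding operad_antimorphism_def Dias_simps by blast
qed

section \<open>Injective self-maps of initial segments\<close>

lemma inj_on_nat_le_self:
  fixes \<sigma> :: "nat \<Rightarrow> nat"
  assumes inj: "inj_on \<sigma> {1..c}" and pos: "\<And>a. a \<in> {1..c} \<Longrightarrow> 1 \<le> \<sigma> a \<and> \<sigma> a \<le> a"
    and a: "a \<in> {1..c}"
  shows "\<sigma> a = a"
  using a
proof (induction a rule: less_induct)
  case (less a)
  show ?case
  proof (rule ccontr)
    assume "\<sigma> a \<noteq> a"
    with pos[OF less.prems] have lt: "\<sigma> a < a" "\<sigma> a \<in> {1..c}" using less.prems by auto
    \<comment> \<open>The smaller value is already fixed by induction, so \<open>a\<close> and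
      \<open>\<sigma> a\<close> would have the same image.\<close>
    then have "\<sigma> (\<sigma> a) = \<sigma> a" using less.IH by blast
    then show False using lt less.prems inj by (auto dest: inj_onD)
  qed
qed

text \<open>Pigeonhole from above: by monotonicity \<open>\<sigma>\<close> injects
  \<open>{b..c}\<close> into \<open>{\<sigma> b..c}\<close>, and comparing cardinalities gives
  \<open>\<sigma> b \<le> b\<close>, so the previous lemma applies.\<close>

lemma inj_mono_on_nat_fixes:
  fixes \<sigma> :: "nat \<Rightarrow> nat"
  assumes inj: "inj_on \<sigma> {1..c}" and mono: "mono_on {1..c} \<sigma>" and "\<sigma> ` {1..c} \<subseteq> {1..c}"
    and a: "a \<in> {1..c}"
  shows "\<sigma> a = a"
proof (rule inj_on_nat_le_self[OF inj _ a])
  fix b assume b: "b \<in> {1..c}"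
  have "\<sigma> d \<in> {\<sigma> b..c}" if "d \<in> {b..c}" for d
  proof -
    have "d \<in> {1..c}" "b \<le> d" using b that by auto
    moreover from this have "\<sigma> d \<in> {1..c}" using assms(3) by blast
    ultimately show ?thesis using mono_onD[OF mono b, of d] by auto
  qed
  then have "\<sigma> ` {b..c} \<subseteq> {\<sigma> b..c}" by blast
  moreover have "inj_on \<sigma> {b..c}" using inj by (rule inj_on_subset) (use b in auto)
  ultimately have "card {b..c} \<le> card {\<sigma> b..c}"
    by (intro card_inj_on_le) auto
  then have "\<sigma> b \<le> b" using b by simp arith
  moreover have "\<sigma> b \<in> {1..c}" using assms(3) b by blast
  ultimately show "1 \<le> \<sigma> b \<and> \<sigma> b \<le> b" by simp
qed

section \<open>Rigidity of injective morphisms\<close>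

lemma morphism_fixes_generators:
  assumes mor: "operad_morphism (Dias \<gamma>) (Dias \<gamma>) g" and inj: "inj_on g (all_ops (Dias \<gamma>))"
    and a: "a \<in> {1..\<gamma>}"
  shows "g [0, a] = [0, a] \<and> g [a, 0] = [a, 0]"
proof -
  have ar: "g x \<in> ops (Dias \<gamma>) n" if "x \<in> ops (Dias \<gamma>) n" for x n
    using mor that by (auto simp: operad_morphism_def)
  have comp: "g (word_comp i x y) = word_comp i (g x) (g y)"
    if "x \<in> ops (Dias \<gamma>) n" "y \<in> ops (Dias \<gamma>) m" "i \<in> {1..n}" for x y n m i
    using mor that by (auto simp: operad_morphism_def)
  have gen: "[0, b] \<in> all_ops (Dias \<gamma>)" "[b, 0] \<in> all_ops (Dias \<gamma>)" if "b \<in> {1..\<gamma>}" for b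
    using Dias_gen[OF that] by (auto simp: all_ops_def)
  have wc2: "word_comp 2 [x, y] [z, w] = [x, max y z, max y w]" for x y z w
    by (simp add: word_comp_def)
  have wc1: "word_comp 1 [x, y] [z, w] = [max x z, max x w, y]" for x y z w
    by (simp add: word_comp_def)
  \<comment> \<open>Before \<open>g\<close> is applied, both composites are the word
    \<open>[0, b, b]\<close>.\<close>
  have eq2: "word_comp 2 (g [0, b]) (g [b, 0]) = word_comp 2 (g [0, b]) (g [0, b])"
    if "b \<in> {1..\<gamma>}" for b
    using comp[OF Dias_gen(1) Dias_gen(2), of b b 2] comp[OF Dias_gen(1) Dias_gen(1), of b b 2] that
    by (simp add: wc2)
  \<comment> \<open>The mirror relation: both composites are \<open>[b, b, 0]\<close>.\<close>
  have eq1: "word_comp 1 (g [b, 0]) (g [0, b]) = word_comp 1 (g [b, 0]) (g [b, 0])"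
    if "b \<in> {1..\<gamma>}" for b
    using comp[OF Dias_gen(2) Dias_gen(1), of b b 1] comp[OF Dias_gen(2) Dias_gen(2), of b b 1] that
    by (simp add: wc1 del: One_nat_def)
  have ne: "g [0, b] \<noteq> g [b, 0]" if "b \<in> {1..\<gamma>}" for b
    using inj gen[OF that] that by (auto dest: inj_onD)
  have L: "\<exists>s\<in>{1..\<gamma>}. g [0, b] = [0, s]" if b: "b \<in> {1..\<gamma>}" for b
    using ar[OF Dias_gen(1)[OF b]]
  proof (cases rule: Dias_arity_2)
    \<comment> \<open>If \<open>g [0, b] = [s, 0]\<close>, the right side of \<open>eq2\<close> is
      \<open>[s, s, 0]\<close>. The left side is \<open>[s, 0, t]\<close> when
      \<open>g [b, 0] = [0, t]\<close>, which would force \<open>s = 0\<close>, and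
      \<open>[s, t, 0]\<close> when \<open>g [b, 0] = [t, 0]\<close>, which would force
      \<open>s = t\<close> against \<open>ne\<close>.\<close>
    case (2 s)
    from ar[OF Dias_gen(2)[OF b]] have False
    proof (cases rule: Dias_arity_2)
      case (1 t)
      with eq2[OF b] 2 show False by (simp add: wc2)
    next
      case (2 t)
      with eq2[OF b] ne[OF b] \<open>g [0, b] = [s, 0]\<close> show False by (simp add: wc2)
    qed
    then show ?thesis ..
  qed blast
  have R: "\<exists>t\<in>{1..\<gamma>}. g [b, 0] = [t, 0]" if b: "b \<in> {1..\<gamma>}" for b
    using ar[OF Dias_gen(2)[OF b]]
  proof (cases rule: Dias_arity_2)
    case (1 s)
    from ar[OF Dias_gen(1)[OF b]] have False
    proof (cases rule: Dias_arity_2)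
      case (1 t)
      with eq1[OF b] ne[OF b] \<open>g [b, 0] = [0, s]\<close> show False by (simp add: wc1 del: One_nat_def)
    next
      case (2 t)
      with eq1[OF b] 1 show False by (simp add: wc1 del: One_nat_def)
    qed
    then show ?thesis ..
  qed blast
  from L obtain \<sigma> where \<sigma>: "\<And>b. b \<in> {1..\<gamma>} \<Longrightarrow> \<sigma> b \<in> {1..\<gamma>} \<and> g [0, b] = [0, \<sigma> b]"
    by metis
  from R obtain \<tau> where \<tau>: "\<And>b. b \<in> {1..\<gamma>} \<Longrightarrow> \<tau> b \<in> {1..\<gamma>} \<and> g [b, 0] = [\<tau> b, 0]"
    by metis
  have inj\<sigma>: "inj_on \<sigma> {1..\<gamma>}"
  proof (rule inj_onI)
    fix b c assume bc: "b \<in> {1..\<gamma>}" "c \<in> {1..\<gamma>}" "\<sigma> b = \<sigma> c"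
    then have "g [0, b] = g [0, c]" using \<sigma> by simp
    then show "b = c" using inj_onD[OF inj _ gen(1)[OF bc(1)] gen(1)[OF bc(2)]] by simp
  qed
  have inj\<tau>: "inj_on \<tau> {1..\<gamma>}"
  proof (rule inj_onI)
    fix b c assume bc: "b \<in> {1..\<gamma>}" "c \<in> {1..\<gamma>}" "\<tau> b = \<tau> c"
    then have "g [b, 0] = g [c, 0]" using \<tau> by simp
    then show "b = c" using inj_onD[OF inj _ gen(2)[OF bc(1)] gen(2)[OF bc(2)]] by simp
  qed
  have mono: "mono_on {1..\<gamma>} \<sigma>"
  proof (rule mono_onI)
    fix b c assume bc: "b \<in> {1..\<gamma>}" "c \<in> {1..\<gamma>}" "b \<le> c"
    \<comment> \<open>For \<open>b \<le> c\<close> both composites come from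
      \<open>[0, c, c]\<close>. The last letters of the images then give
      \<open>max (\<sigma> c) (\<sigma> b) = \<sigma> c\<close>.\<close>
    then have "word_comp 2 (g [0, c]) (g [0, b]) = word_comp 2 (g [0, c]) (g [0, c])"
      using comp[OF Dias_gen(1) Dias_gen(1), of c b 2] comp[OF Dias_gen(1) Dias_gen(1), of c c 2]
      by (simp add: wc2)
    then show "\<sigma> b \<le> \<sigma> c" using \<sigma>[OF bc(1)] \<sigma>[OF bc(2)] by (simp add: wc2)
  qed
  have fix\<sigma>: "\<sigma> b = b" if "b \<in> {1..\<gamma>}" for b
    using inj_mono_on_nat_fixes[OF inj\<sigma> mono _ that] \<sigma> by blast
  \<comment> \<open>The middle letters in \<open>eq2\<close> give
    \<open>max (\<sigma> b) (\<tau> b) = \<sigma> b\<close>, where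
    \<open>\<sigma> b = b\<close>.\<close>
  have "\<tau> b \<le> b" if "b \<in> {1..\<gamma>}" for b
    using eq2[OF that] \<sigma>[OF that] \<tau>[OF that] fix\<sigma>[OF that] by (simp add: wc2)
  then have "\<tau> a = a"
    using inj_on_nat_le_self[OF inj\<tau> _ a] \<tau> by force
  then show ?thesis using \<sigma>[OF a] \<tau>[OF a] fix\<sigma>[OF a] by simp
qed

lemma Dias_injective_morphism_id:
  assumes mor: "operad_morphism (Dias \<gamma>) (Dias \<gamma>) g" and inj: "inj_on g (all_ops (Dias \<gamma>))"
    and w: "w \<in> all_ops (Dias \<gamma>)"
  shows "g w = w"
proof -
  from w obtain n where "w \<in> ops (Dias \<gamma>) n" by (auto simp: all_ops_def)
  then show ?thesis
  proof (induction rule: Dias_induct)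
    case unit
    then show ?case using mor by (simp add: operad_morphism_def)
  next
    case (comp n x m y i)
    then have "g (word_comp i x y) = word_comp i (g x) (g y)"
      using mor by (auto simp: operad_morphism_def)
    with comp show ?case by simp
  qed (use morphism_fixes_generators[OF mor inj] in auto)
qed

lemma rev_comp_antimorphism:
  assumes anti: "operad_antimorphism (Dias \<gamma>) (Dias \<gamma>) g"
  shows "operad_morphism (Dias \<gamma>) (Dias \<gamma>) (rev \<circ> g)"
proof -
  have ar: "g x \<in> ops (Dias \<gamma>) n" if "x \<in> ops (Dias \<gamma>) n" for x n
    using anti that by (auto simp: operad_antimorphism_def)
  have "rev (g (word_comp i x y)) = word_comp i (rev (g x)) (rev (g y))"
    if "x \<in> ops (Dias \<gamma>) n" "y \<in> ops (Dias \<gamma>) m" "i \<in> {1..n}" for x y n m i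
  proof -
    have "g (word_comp i x y) = word_comp (n - i + 1) (g x) (g y)"
      using anti that unfolding operad_antimorphism_def Dias_simps by blast
    moreover have "length (g x) = n" using ar[OF that(1)] Dias_words by blast
    \<comment> \<open>Two reflections restore the position; the natural subtractions are exact
      because \<open>1 \<le> i \<le> n\<close>.\<close>
    moreover have "n - (n - i + 1) + 1 = i" "n - i + 1 \<in> {1..n}" using that(3) by auto
    ultimately show ?thesis using rev_word_comp[of "n - i + 1" "g x" "g y"] by metis
  qed
  \<comment> \<open>Preservation of the unit follows from arities: \<open>[0]\<close> is the only
    element of arity one.\<close>
  moreover have "g [0] = [0]" using ar[OF Dias_unit] by (rule Dias_arity_1)
  ultimately show ?thesis using ar Dias_rev by (auto simp: operad_morphism_def)
qed

section \<open>Classification of the symmetries\<close>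

lemma Dias_symmetry_cases:
  assumes "f \<in> (symmetries (Dias \<gamma>) :: ((nat list \<Rightarrow>\<^sub>0 'k::field) \<Rightarrow> (nat list \<Rightarrow>\<^sub>0 'k)) set)"
  shows "f = (\<lambda>x\<in>span_space (Dias \<gamma>). x) \<or>
    f = (\<lambda>x\<in>span_space (Dias \<gamma>). linear_extension rev x)"
proof -
  obtain g where inj: "inj_on g (all_ops (Dias \<gamma>))"
    and mor: "operad_morphism (Dias \<gamma>) (Dias \<gamma>) g \<or> operad_antimorphism (Dias \<gamma>) (Dias \<gamma>) g"
    and f: "f = restrict (linear_extension g) (span_space (Dias \<gamma>))"
    using Dias_closed by (rule symmetryE[OF assms])
  from mor show ?thesis
  proof
    assume "operad_morphism (Dias \<gamma>) (Dias \<gamma>) g"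
    then have "g u = u" if "u \<in> all_ops (Dias \<gamma>)" for u
      using Dias_injective_morphism_id inj that by blast
    then have "linear_extension g x = x" if "x \<in> span_space (Dias \<gamma>)" for x :: "nat list \<Rightarrow>\<^sub>0 'k"
      using that by (intro linear_extension_id) (auto simp: span_space_def)
    then show ?thesis using f by (auto simp: restrict_def)
  next
    assume "operad_antimorphism (Dias \<gamma>) (Dias \<gamma>) g"
    then have "operad_morphism (Dias \<gamma>) (Dias \<gamma>) (rev \<circ> g)"
      by (rule rev_comp_antimorphism)
    moreover have "inj_on (rev \<circ> g) (all_ops (Dias \<gamma>))"
      using inj by (simp add: comp_inj_on inj_on_rev)
    \<comment> \<open>Rigidity applies to \<open>rev \<circ> g\<close>, and reversing once more
      identifies \<open>g\<close> with \<open>rev\<close> on the words of Dias.\<close>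
    ultimately have "rev (g u) = u" if "u \<in> all_ops (Dias \<gamma>)" for u
      using Dias_injective_morphism_id[of \<gamma> "rev \<circ> g" u] that by simp
    then have "g u = rev u" if "u \<in> all_ops (Dias \<gamma>)" for u
      using that by (metis rev_rev_ident)
    then have "linear_extension g x = linear_extension rev x"
      if "x \<in> span_space (Dias \<gamma>)" for x :: "nat list \<Rightarrow>\<^sub>0 'k"
      using that unfolding linear_extension_def
      by (intro sum.cong) (auto simp: span_space_def)
    then show ?thesis using f by (auto simp: restrict_def)
  qed
qed

lemma symmetries_Dias:
  "(symmetries (Dias \<gamma>) :: ((nat list \<Rightarrow>\<^sub>0 'k::field) \<Rightarrow> (nat list \<Rightarrow>\<^sub>0 'k)) set) =
    {\<lambda>x\<in>span_space (Dias \<gamma>). x, \<lambda>x\<in>span_space (Dias \<gamma>). linear_extension rev x}"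
proof -
  \<comment> \<open>The identity is written as the extension of \<open>id\<close> so that the same
    criterion serves both maps.\<close>
  have "(\<lambda>x\<in>span_space (Dias \<gamma>). linear_extension id x) \<in>
      (symmetries (Dias \<gamma>) :: ((nat list \<Rightarrow>\<^sub>0 'k) \<Rightarrow> _) set)"
    by (rule linear_extension_in_symmetries)
      (use Dias_closed in \<open>auto simp: operad_morphism_def\<close>)
  then have "(\<lambda>x\<in>span_space (Dias \<gamma>). x) \<in>
      (symmetries (Dias \<gamma>) :: ((nat list \<Rightarrow>\<^sub>0 'k) \<Rightarrow> _) set)"
    by (simp add: linear_extension_id)
  moreover have "rev ` ops (Dias \<gamma>) n = ops (Dias \<gamma>) n" for n
    using Dias_rev by (force simp: image_iff intro: rev_rev_ident[symmetric])
  then have "(\<lambda>x\<in>span_space (Dias \<gamma>). linear_extension rev x) \<in>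
      (symmetries (Dias \<gamma>) :: ((nat list \<Rightarrow>\<^sub>0 'k) \<Rightarrow> _) set)"
    using operad_antimorphism_rev Dias_closed
    by (intro linear_extension_in_symmetries) (auto intro: involuntory_imp_bij)
  ultimately show ?thesis using Dias_symmetry_cases by blast
qed

text \<open>The cardinality is asserted for \<open>\<gamma> \<ge> 1\<close>: when
  \<open>\<gamma> = 0\<close> the only word is \<open>[0]\<close>, a palindrome, and the two listed
  maps coincide.\<close>

theorem proposition2p3p2:
  fixes \<gamma> :: nat
  defines "S \<equiv> (symmetry_group (Dias \<gamma>) :: ((nat list \<Rightarrow>\<^sub>0 'k::field) \<Rightarrow> (nat list \<Rightarrow>\<^sub>0 'k)) monoid)"
  shows "group S \<and>
         carrier S = {\<lambda>x\<in>span_space (Dias \<gamma>). x,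
                      \<lambda>x\<in>span_space (Dias \<gamma>). linear_extension rev x} \<and>
         (\<gamma> \<ge> 1 \<longrightarrow> card (carrier S) = 2)"
proof -
  let ?V = "span_space (Dias \<gamma>) :: (nat list \<Rightarrow>\<^sub>0 'k) set"
  let ?B = "BijGroup ?V"
  let ?e = "\<lambda>x\<in>?V. x" and ?r = "\<lambda>x\<in>?V. linear_extension rev x"
  have car: "carrier S = {?e, ?r}"
    by (simp add: S_def symmetry_group_def symmetries_Dias)
  have Bij: "?e \<in> Bij ?V" "?r \<in> Bij ?V"
    using symmetries_Dias[of \<gamma>, where 'k = 'k] by (auto simp: symmetries_def)
  interpret B: group ?B by (rule group_BijGroup)
  have e: "\<one>\<^bsub>?B\<^esub> = ?e" by (simp add: BijGroup_def)
  have mem: "?e \<in> carrier ?B" "?r \<in> carrier ?B" using Bij by (simp_all add: BijGroup_def)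
  \<comment> \<open>The map \<open>?r\<close> is an involution because \<open>rev\<close> is;
    together with the identity it therefore forms a subgroup of the group of all bijections.\<close>
  have rr: "?r \<otimes>\<^bsub>?B\<^esub> ?r = \<one>\<^bsub>?B\<^esub>"
  proof -
    have "?r x \<in> ?V" if "x \<in> ?V" for x
      using Bij(2) that by (blast dest: Bij_imp_funcset)
    then show ?thesis
      using Bij by (auto simp: BijGroup_def compose_def linear_extension_comp linear_extension_id
          intro!: restrict_ext)
  qed
  then have inv_r: "inv\<^bsub>?B\<^esub> ?r = ?r" using mem by (intro B.inv_equality)
  have "subgroup {\<one>\<^bsub>?B\<^esub>, ?r} ?B"
    by (rule B.subgroupI) (use mem rr inv_r in auto)
  then have "group (?B\<lparr>carrier := {\<one>\<^bsub>?B\<^esub>, ?r}\<rparr>)"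
    by (rule B.subgroup_imp_group)
  then have "group S"
    by (simp add: S_def symmetry_group_def symmetries_Dias e)
  moreover have "card (carrier S) = 2" if "\<gamma> \<ge> 1"
  proof -
    \<comment> \<open>A generator that is not a palindrome, available since
      \<open>1 \<le> \<gamma>\<close>, separates the two maps.\<close>
    let ?x = "Poly_Mapping.single [0, 1] 1 :: nat list \<Rightarrow>\<^sub>0 'k"
    have "?x \<in> ?V"
      using Dias_gen(1)[of 1 \<gamma>] that by (auto simp: span_space_def all_ops_def)
    moreover have "Poly_Mapping.single [1, 0] 1 \<noteq> ?x"
      by (auto dest: single_one_inj)
    ultimately have "?e ?x \<noteq> ?r ?x" by auto
    then have "?e \<noteq> ?r" by metis
    then show ?thesis by (simp add: car)
  qed
  ultimately show ?thesis using car by blast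
qed

end
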